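(* Let $d\ge 1$, let $\underline u<\overline u$ and $M>0$ be real numbers, let $E:=S^d\times\overline{B(0,M)}\times[\underline u,\overline u]\times Q$, and let $F=F(X,p,u,x,t)$ be a real function defined on $E$ such that: (i) $F\in C^1(E)$; (ii) for all $X,Y\in S^d$ and all $(p,u,x,t)\in \overline{B(0,M)}\times[\underline u,\overline u]\times Q$, if $X\le Y$ then $F(X,p,u,x,t)\le F(Y,p,u,x,t)$; (iii) for all $(X,p,u,x,t)\in E$ such that $X\cdot p=0$, $$-D_XF:X^2+|p|^2D_uF+D_xF\cdot p\le 0,$$ where the derivatives of $F$ are evaluated at $(X,p,u,x,t)$. Let $u\in C^3(\overline Q)$ be a solution of $$u_t=F(D^2u,Du,u,x,t)\quad\text{for }(x,t)\in Q,\qquad u(x,0)=u_0(x)\quad\text{for }x\in\mathbb{T}^d,$$ such that for all $t\ge 0$ $$\underline u\le u(\cdot,t)\le\overline u\quad\text{and}\quad \|Du(\cdot,t)\|_{L^\infty(\mathbb{T}^d)}\le M.$$ Then for all $t\ge 0$ $$\|Du(\cdot,t)\|_{L^\infty(\mathbb{T}^d)}\le\|Du_0\|_{L^\infty(\mathbb{T}^d)}.$$ Moreover, if in addition $F(0,0,C,x,t)=0$ for every constant $C\in[\underline u,\overline u]$ and every $(x,t)\in Q$, then for all $t\ge 0$ $$\min_{\mathbb{T}^d}u_0\le u(\cdot,t)\le\max_{\mathbb{T}^d}u_0.$$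
   Context: $\mathbb{T}^d=(\mathbb{R}/\mathbb{Z})^d$ is the $d$-dimensional torus, $Q:=\mathbb{T}^d\times(0,+\infty)$ and $\overline Q=\mathbb{T}^d\times[0,+\infty)$. $S^d$ is the space of real symmetric $d\times d$ matrices, with the usual order ($X\le Y$ iff $Y-X$ is positive semidefinite). $\overline{B(0,M)}$ is the closed Euclidean ball of radius $M$ in $\mathbb{R}^d$. For $X,Y\in S^d$, $X:Y=\mathrm{tr}(XY)$; for $p,q\in\mathbb{R}^d$, $(X\cdot p)_i=\sum_j x_{ij}p_j$ and $p\cdot q=\sum_j p_jq_j$; $|\cdot|$ is the Euclidean norm. $D_XF$ (a symmetric matrix, the gradient with respect to $X\in S^d$ for the inner product $:$), $D_pF$, $D_uF$, $D_xF$ denote the partial derivatives of $F$; $C^1(E)$ means continuously differentiable up to the boundary in the variables $p$ and $u$. $Du$ and $D^2u$ are the gradient and Hessian of $u$ in the space variable $x$, and $\|Du(\cdot,t)\|_{L^\infty(\mathbb{T}^d)}$ is the supremum over $x\in\mathbb{T}^d$ of the Euclidean norm $|Du(x,t)|$. *)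

theory Defs
  imports "HOL-Analysis.Analysis"
begin

text \<open>
  Functions on the torus \<open>(\<real>/\<int>)^d\<close> are represented by their lifts, i.e. by functions on
  \<^typ>\<open>real ^ 'n\<close>, \<open>d = CARD('n)\<close>, that are invariant under translation by the following lattice.
\<close>

definition int_lattice :: "(real ^ 'n) set" where
  "int_lattice = {k. \<forall>i. k $ i \<in> \<int>}"

text \<open>
  \<open>C^k\<close> up to the boundary: derivatives are taken within \<open>S\<close> and are continuous on \<open>S\<close>. The sets
  this is used for are convex with nonempty interior in their affine hull, which makes this
  agree with asking for continuous extensions of the derivatives from the (relative) interior.
  When \<open>S\<close> spans a proper subspace, the component of \<open>G\<close> normal to it is not determined by \<open>f\<close>;
  it is only required that some choice works.
\<close>

primrec Ck_on :: "nat \<Rightarrow> 'a::euclidean_space set \<Rightarrow> ('a \<Rightarrow> real) \<Rightarrow> bool" where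
  "Ck_on 0 S f \<longleftrightarrow> continuous_on S f"
| "Ck_on (Suc k) S f \<longleftrightarrow>
     (\<exists>G. (\<forall>z\<in>S. (f has_derivative (\<lambda>h. G z \<bullet> h)) (at z within S)) \<and>
          (\<forall>b\<in>Basis. Ck_on k S (\<lambda>z. G z \<bullet> b)))"

definition grad :: "('a::real_inner \<Rightarrow> real) \<Rightarrow> 'a \<Rightarrow> 'a" where
  "grad f x = (THE g. GDERIV f x :> g)"

definition hess :: "(real ^ 'n \<Rightarrow> real) \<Rightarrow> real ^ 'n \<Rightarrow> real ^ 'n ^ 'n" where
  "hess f x = jacobian (grad f) (at x)"

definition sym_mats :: "(real ^ 'n ^ 'n) set" where
  "sym_mats = {X. transpose X = X}"

definition mat_le :: "real ^ 'n ^ 'n \<Rightarrow> real ^ 'n ^ 'n \<Rightarrow> bool" where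
  "mat_le X Y \<longleftrightarrow> (\<forall>\<xi>. 0 \<le> \<xi> \<bullet> ((Y - X) *v \<xi>))"

definition frob :: "real ^ 'n ^ 'n \<Rightarrow> real ^ 'n ^ 'n \<Rightarrow> real" where
  "frob X Y = trace (X ** Y)"

text \<open>The points \<open>(X, p, u, x, t)\<close> at which \<open>F\<close> is defined, lifted in the torus variable \<open>x\<close>.\<close>

type_synonym 'n point = "(real ^ 'n ^ 'n) \<times> (real ^ 'n) \<times> real \<times> (real ^ 'n) \<times> real"

definition E_dom :: "real \<Rightarrow> real \<Rightarrow> real \<Rightarrow> ('n::finite) point set" where
  "E_dom ul uu M = sym_mats \<times> cball 0 M \<times> {ul..uu} \<times> UNIV \<times> {0<..}"

text \<open>
  The gradient in \<open>X\<close> is taken within the space of symmetric matrices, the derivative in \<open>u\<close>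
  within \<open>[ul, uu]\<close> (hence one-sided at the end points).
\<close>

definition D_X :: "(('n::finite) point \<Rightarrow> real) \<Rightarrow> 'n point \<Rightarrow> real ^ 'n ^ 'n" where
  "D_X F = (\<lambda>(X, p, v, x, t). THE A. A \<in> sym_mats \<and>
     ((\<lambda>Y. F (Y, p, v, x, t)) has_derivative (\<lambda>H. frob A H)) (at X within sym_mats))"

definition D_u :: "real \<Rightarrow> real \<Rightarrow> (('n::finite) point \<Rightarrow> real) \<Rightarrow> 'n point \<Rightarrow> real" where
  "D_u ul uu F = (\<lambda>(X, p, v, x, t).
     vector_derivative (\<lambda>w. F (X, p, w, x, t)) (at v within {ul..uu}))"

definition D_x :: "(('n::finite) point \<Rightarrow> real) \<Rightarrow> 'n point \<Rightarrow> real ^ 'n" where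
  "D_x F = (\<lambda>(X, p, v, x, t). grad (\<lambda>y. F (X, p, v, y, t)) x)"

text \<open>
  The supremum over the torus is the supremum over \<^typ>\<open>real ^ 'n\<close> of the periodic lift. It is only
  used for continuous \<open>g\<close>, which are bounded by periodicity.
\<close>

definition Linf_norm :: "(real ^ 'n \<Rightarrow> real ^ 'n) \<Rightarrow> real" where
  "Linf_norm g = (SUP x. norm (g x))"

end

theory Submission imports Defs begin

text \<open>
  The function \<open>w = |Du|\<^sup>2\<close> satisfies \<open>w\<^sub>t \<le> 0\<close> at every spatial maximum. There \<open>Dw = 0\<close>
  means \<open>X \<cdot> p = 0\<close> for \<open>X = D\<^sup>2u\<close>, \<open>p = Du\<close>, and \<open>D\<^sup>2w \<le> 0\<close> means \<open>Y \<le> -X\<^sup>2\<close> for the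
  derivative \<open>Y\<close> of \<open>D\<^sup>2u\<close> in direction \<open>p\<close>. Differentiating the equation in direction \<open>p\<close>,
  where the \<open>D\<^sub>pF\<close> term drops out because \<open>X \<cdot> p = 0\<close>, gives
  \<open>w\<^sub>t / 2 = D\<^sub>XF : Y + |p|\<^sup>2 D\<^sub>uF + D\<^sub>xF \<cdot> p\<close>, which ellipticity bounds by the left-hand side of (iii).
  A maximum of \<open>w - \<epsilon>t\<close> over a period cell times \<open>[0, T]\<close> can therefore only be attained at \<open>t = 0\<close>.
  The bounds on \<open>u\<close> follow in the same way from \<open>u\<^sub>t = F(D\<^sup>2u, 0, u, x, t) \<le> F(0, 0, u, x, t) = 0\<close>
  at a spatial maximum of \<open>u\<close>.
\<close>

text \<open>The direction comes first and the point last, so that \<open>dderiv h f\<close> is again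
  a real function. Second and third derivatives are then iterated directional derivatives, without
  multilinear maps.\<close>

abbreviation dderiv :: "'a::real_normed_vector \<Rightarrow> ('a \<Rightarrow> real) \<Rightarrow> 'a \<Rightarrow> real" where
  "dderiv h f z \<equiv> frechet_derivative f (at z) h"

section \<open>Closure properties of \<open>Ck_on\<close>\<close>

lemma Ck_on_subset: "Ck_on k S f \<Longrightarrow> T \<subseteq> S \<Longrightarrow> Ck_on k T f"
proof (induction k arbitrary: f)
  case 0
  then show ?case by (auto intro: continuous_on_subset)
next
  case (Suc k)
  obtain G where G: "\<And>z. z \<in> S \<Longrightarrow> (f has_derivative (\<lambda>h. G z \<bullet> h)) (at z within S)"
     "\<And>b. b \<in> Basis \<Longrightarrow> Ck_on k S (\<lambda>z. G z \<bullet> b)"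
    using Suc.prems(1) unfolding Ck_on.simps(2) by blast
  have "(f has_derivative (\<lambda>h. G z \<bullet> h)) (at z within T)" if "z \<in> T" for z
    using G(1)[of z] that Suc.prems(2) has_derivative_subset by blast
  then show ?case
    using Suc.IH[OF G(2) Suc.prems(2)] by auto
qed

lemma Ck_on_cong: "Ck_on k S f \<Longrightarrow> (\<And>z. z \<in> S \<Longrightarrow> f z = g z) \<Longrightarrow> Ck_on k S g"
proof (induction k arbitrary: f g)
  case 0
  then show ?case using continuous_on_cong[of S S f g] by simp
next
  case (Suc k)
  obtain G where G: "\<And>z. z \<in> S \<Longrightarrow> (f has_derivative (\<lambda>h. G z \<bullet> h)) (at z within S)"
     "\<And>b. b \<in> Basis \<Longrightarrow> Ck_on k S (\<lambda>z. G z \<bullet> b)"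
    using Suc.prems(1) unfolding Ck_on.simps(2) by blast
  have "(g has_derivative (\<lambda>h. G z \<bullet> h)) (at z within S)" if "z \<in> S" for z
    using has_derivative_transform[OF that _ G(1)[OF that], of g] Suc.prems(2) by simp
  then show ?case
    using G(2) by auto
qed

lemma Ck_on_SucD: "Ck_on (Suc k) S f \<Longrightarrow> Ck_on k S f"
proof (induction k arbitrary: f)
  case 0
  then show ?case
    by (auto simp: continuous_on_eq_continuous_within dest: has_derivative_continuous)
next
  case (Suc k)
  then obtain G where G: "\<And>z. z \<in> S \<Longrightarrow> (f has_derivative (\<lambda>h. G z \<bullet> h)) (at z within S)"
     "\<And>b. b \<in> Basis \<Longrightarrow> Ck_on (Suc k) S (\<lambda>z. G z \<bullet> b)"
    by (subst (asm) Ck_on.simps(2)) blast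
  show ?case
    using G(1) Suc.IH[OF G(2)] by auto
qed

lemma Ck_on_mono: "Ck_on k S f \<Longrightarrow> j \<le> k \<Longrightarrow> Ck_on j S f"
proof (induction k)
  case (Suc k)
  then show ?case using Ck_on_SucD[of k S f] by (auto simp: le_Suc_eq simp del: Ck_on.simps)
qed simp

lemma Ck_on_zero: "Ck_on k S (\<lambda>z. 0)"
proof (induction k)
  case (Suc k)
  then show ?case by (auto intro!: exI[of _ "\<lambda>_. 0"])
qed simp

lemma Ck_on_add: "Ck_on k S f \<Longrightarrow> Ck_on k S g \<Longrightarrow> Ck_on k S (\<lambda>z. f z + g z)"
proof (induction k arbitrary: f g)
  case 0
  then show ?case by (auto intro: continuous_on_add)
next
  case (Suc k)
  obtain G H where
    "\<And>z. z \<in> S \<Longrightarrow> (f has_derivative (\<lambda>h. G z \<bullet> h)) (at z within S)"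
    "\<And>b. b \<in> Basis \<Longrightarrow> Ck_on k S (\<lambda>z. G z \<bullet> b)"
    "\<And>z. z \<in> S \<Longrightarrow> (g has_derivative (\<lambda>h. H z \<bullet> h)) (at z within S)"
    "\<And>b. b \<in> Basis \<Longrightarrow> Ck_on k S (\<lambda>z. H z \<bullet> b)"
    using Suc.prems unfolding Ck_on.simps(2) by blast
  then show ?case
    using Suc.IH
    by (auto intro!: exI[of _ "\<lambda>z. G z + H z"] derivative_eq_intros simp: inner_add_left)
qed

lemma Ck_on_cmult: "Ck_on k S f \<Longrightarrow> Ck_on k S (\<lambda>z. c * f z)"
proof (induction k arbitrary: f)
  case 0
  then show ?case by (auto intro: continuous_on_mult_left)
next
  case (Suc k)
  then obtain G where
    "\<And>z. z \<in> S \<Longrightarrow> (f has_derivative (\<lambda>h. G z \<bullet> h)) (at z within S)"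
    "\<And>b. b \<in> Basis \<Longrightarrow> Ck_on k S (\<lambda>z. G z \<bullet> b)"
    by auto
  then show ?case
    using Suc.IH
    by (auto intro!: exI[of _ "\<lambda>z. c *\<^sub>R G z"] derivative_eq_intros)
qed

lemma Ck_on_sum: "finite I \<Longrightarrow> (\<And>i. i \<in> I \<Longrightarrow> Ck_on k S (f i)) \<Longrightarrow> Ck_on k S (\<lambda>z. \<Sum>i\<in>I. f i z)"
  by (induction I rule: finite_induct) (auto intro: Ck_on_zero Ck_on_add)

text \<open>\<open>Ck_on\<close> controls the gradient only along basis vectors. Expanding
  \<open>h\<close> in the basis passes the regularity on to every direction.\<close>

lemma Ck_on_inner:
  assumes "\<And>b. b \<in> Basis \<Longrightarrow> Ck_on k S (\<lambda>z. G z \<bullet> b)"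
  shows "Ck_on k S (\<lambda>z. G z \<bullet> h)"
proof -
  have "Ck_on k S (\<lambda>z. \<Sum>b\<in>Basis. (h \<bullet> b) * (G z \<bullet> b))"
    using assms by (intro Ck_on_sum Ck_on_cmult) auto
  then show ?thesis
    by (rule Ck_on_cong) (simp add: euclidean_inner[of _ h] mult.commute)
qed

text \<open>Openness turns the derivative within \<open>S\<close> into the full derivative, so the
  witness \<open>G z\<close> of \<open>Ck_on\<close> is the true gradient and
  \<open>dderiv h f z\<close> is its inner product with \<open>h\<close>.\<close>

lemma
  assumes "Ck_on (Suc k) S f" "open S"
  shows Ck_on_imp_differentiable: "z \<in> S \<Longrightarrow> f differentiable (at z)"
    and Ck_on_dderiv: "Ck_on k S (dderiv h f)"
proof -
  obtain G where G: "\<And>z. z \<in> S \<Longrightarrow> (f has_derivative (\<lambda>h. G z \<bullet> h)) (at z within S)"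
     "\<And>b. b \<in> Basis \<Longrightarrow> Ck_on k S (\<lambda>z. G z \<bullet> b)"
    using assms by auto
  have G1: "(f has_derivative (\<lambda>h. G z \<bullet> h)) (at z)" if "z \<in> S" for z
    using G(1)[OF that] at_within_open[OF that \<open>open S\<close>] by simp
  show "z \<in> S \<Longrightarrow> f differentiable (at z)"
    using G1 differentiable_def by blast
  show "Ck_on k S (dderiv h f)"
    using Ck_on_inner[OF G(2), of h] 
    by (rule Ck_on_cong) (simp_all add: frechet_derivative_at[OF G1, symmetric])
qed

section \<open>Symmetry of second derivatives and the second derivative test\<close>

lemma dderiv_line:
  assumes "f differentiable (at (z + s *\<^sub>R h))"
  shows "((\<lambda>r. f (z + r *\<^sub>R h)) has_real_derivative dderiv h f (z + s *\<^sub>R h)) (at s)"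
proof -
  have "((\<lambda>r. f (z + r *\<^sub>R h)) has_derivative
      (\<lambda>r. frechet_derivative f (at (z + s *\<^sub>R h)) (r *\<^sub>R h))) (at s)"
    by (rule has_derivative_compose[where f = "\<lambda>r. z + r *\<^sub>R h", OF _ assms[unfolded frechet_derivative_works]])
       (auto intro!: derivative_eq_intros)
  then show ?thesis
    using linear_frechet_derivative[OF assms]
    by (simp add: has_field_derivative_def linear_cmul mult_commute_abs)
qed

text \<open>Two applications of the mean value theorem: first along \<open>h\<close> to the
  difference of \<open>f\<close> on two parallel segments, then along \<open>k\<close> to
  \<open>dderiv h f\<close>. All intermediate points lie in the parallelogram required to be in
  \<open>S\<close>.\<close>

lemma second_difference:
  assumes f: "\<And>w. w \<in> S \<Longrightarrow> f differentiable (at w)"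
    and g: "\<And>w. w \<in> S \<Longrightarrow> dderiv h f differentiable (at w)"
    and s: "0 < s" and S: "\<And>a b. 0 \<le> a \<Longrightarrow> a \<le> s \<Longrightarrow> 0 \<le> b \<Longrightarrow> b \<le> s \<Longrightarrow> z + a *\<^sub>R h + b *\<^sub>R k \<in> S"
  obtains a b where "0 \<le> a" "a \<le> s" "0 \<le> b" "b \<le> s"
    "f (z + s *\<^sub>R h + s *\<^sub>R k) - f (z + s *\<^sub>R h) - f (z + s *\<^sub>R k) + f z
      = s\<^sup>2 * dderiv k (dderiv h f) (z + a *\<^sub>R h + b *\<^sub>R k)"
proof -
  define \<phi> where "\<phi> r = f (z + s *\<^sub>R k + r *\<^sub>R h) - f (z + r *\<^sub>R h)" for r
  have "\<exists>a>0. a < s \<and> \<phi> s - \<phi> 0 = (s - 0) * (dderiv h f (z + s *\<^sub>R k + a *\<^sub>R h) - dderiv h f (z + a *\<^sub>R h))"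
  proof (rule MVT2[OF s])
    fix r assume r: "0 \<le> r" "r \<le> s"
    show "(\<phi> has_real_derivative dderiv h f (z + s *\<^sub>R k + r *\<^sub>R h) - dderiv h f (z + r *\<^sub>R h)) (at r)"
      unfolding \<phi>_def using S[OF r, of s] S[OF r, of 0] s
      by (intro DERIV_diff dderiv_line f) (auto simp: ac_simps)
  qed
  then obtain a where a: "0 < a" "a < s"
    "\<phi> s - \<phi> 0 = s * (dderiv h f (z + s *\<^sub>R k + a *\<^sub>R h) - dderiv h f (z + a *\<^sub>R h))"
    by auto
  have "\<exists>b>0. b < s \<and> dderiv h f (z + a *\<^sub>R h + s *\<^sub>R k) - dderiv h f (z + a *\<^sub>R h + 0 *\<^sub>R k)
     = (s - 0) * dderiv k (dderiv h f) (z + a *\<^sub>R h + b *\<^sub>R k)"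
    using a by (intro MVT2[OF s] dderiv_line g S) auto
  then obtain b where b: "0 < b" "b < s" "dderiv h f (z + a *\<^sub>R h + s *\<^sub>R k) - dderiv h f (z + a *\<^sub>R h)
     = s * dderiv k (dderiv h f) (z + a *\<^sub>R h + b *\<^sub>R k)"
    by auto
  show ?thesis
  proof (rule that[of a b])
    show "f (z + s *\<^sub>R h + s *\<^sub>R k) - f (z + s *\<^sub>R h) - f (z + s *\<^sub>R k) + f z
      = s\<^sup>2 * dderiv k (dderiv h f) (z + a *\<^sub>R h + b *\<^sub>R k)"
      using a(3) b(3) by (simp add: \<phi>_def power2_eq_square algebra_simps)
  qed (use a b in auto)
qed

text \<open>The second difference is symmetric in \<open>h\<close> and \<open>k\<close>. Written by
  \<open>second_difference\<close> in both orders, it equates values of the two mixed derivatives at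
  points near \<open>z\<close>, and continuity carries this over to \<open>z\<close>.\<close>

lemma dderiv_commute:
  assumes f: "Ck_on 2 S f" and S: "open S" "z \<in> S"
  shows "dderiv h (dderiv k f) z = dderiv k (dderiv h f) z"
proof -
  have f2: "Ck_on (Suc (Suc 0)) S f" using f by (simp add: numeral_2_eq_2)
  have d0: "f differentiable (at w)" if "w \<in> S" for w
    using Ck_on_imp_differentiable[OF f2 S(1)] that by auto
  have d1: "dderiv l f differentiable (at w)" if "w \<in> S" for w l
    using Ck_on_imp_differentiable[OF Ck_on_dderiv[OF f2 S(1)] S(1)] that by auto
  have c: "isCont (dderiv l (dderiv m f)) z" for l m
  proof -
    have "continuous_on S (dderiv l (dderiv m f))"
      using Ck_on_dderiv[OF Ck_on_dderiv[OF f2 S(1)] S(1)] by simp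
    then show ?thesis
      using S by (simp add: continuous_on_eq_continuous_at)
  qed
  show ?thesis
  proof (rule ccontr)
    assume ne: "\<not> ?thesis"
    \<comment> \<open>Half the gap: a common value within \<open>e\<close> of both mixed derivatives
      at \<open>z\<close> is impossible.\<close>
    define e where "e = \<bar>dderiv h (dderiv k f) z - dderiv k (dderiv h f) z\<bar> / 2"
    have e: "e > 0" using ne by (simp add: e_def)
    obtain r where r: "r > 0" "ball z r \<subseteq> S" by (rule openE[OF S])
    have cont_e: "\<exists>d>0. \<forall>w. dist w z < d \<longrightarrow> dist (dderiv l (dderiv m f) w) (dderiv l (dderiv m f) z) < e" for l m
      using c[where l=l and m=m] e unfolding continuous_at_eps_delta by blast
    obtain d1' where d1': "d1' > 0" "\<And>w. dist w z < d1' \<Longrightarrow> dist (dderiv h (dderiv k f) w) (dderiv h (dderiv k f) z) < e"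
      using cont_e[where l=h and m=k] by auto
    obtain d2' where d2': "d2' > 0" "\<And>w. dist w z < d2' \<Longrightarrow> dist (dderiv k (dderiv h f) w) (dderiv k (dderiv h f) z) < e"
      using cont_e[where l=k and m=h] by auto
    define \<delta> where "\<delta> = min r (min d1' d2')"
    have \<delta>: "\<delta> > 0" using r d1' d2' by (simp add: \<delta>_def)
    \<comment> \<open>This side length puts the whole parallelogram into the ball of radius
      \<open>\<delta>\<close>. The summand 1 makes the bound strict and covers
      \<open>h = k = 0\<close>.\<close>
    define s where "s = \<delta> / (norm h + norm k + 1)"
    have pos: "norm h + norm k + 1 > 0" by (smt (verit) norm_ge_zero)
    have s: "s > 0" using \<delta> pos by (simp add: s_def)
    have near: "dist (z + a *\<^sub>R h + b *\<^sub>R k) z < \<delta>" if "0 \<le> a" "a \<le> s" "0 \<le> b" "b \<le> s" for a b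
    proof -
      have "dist (z + a *\<^sub>R h + b *\<^sub>R k) z \<le> norm (a *\<^sub>R h) + norm (b *\<^sub>R k)"
        using norm_triangle_ineq[of "a *\<^sub>R h" "b *\<^sub>R k"] by (simp add: dist_norm add.assoc)
      also have "\<dots> \<le> s * norm h + s * norm k"
        using that by (auto intro!: add_mono mult_right_mono)
      also have "\<dots> < s * (norm h + norm k + 1)" using s by (simp add: algebra_simps)
      also have "\<dots> = \<delta>" using pos by (simp add: s_def)
      finally show ?thesis .
    qed
    have inS: "z + a *\<^sub>R h + b *\<^sub>R k \<in> S" if "0 \<le> a" "a \<le> s" "0 \<le> b" "b \<le> s" for a b
      using near[OF that] r by (auto simp: \<delta>_def dist_commute)
    obtain a b where ab: "0 \<le> a" "a \<le> s" "0 \<le> b" "b \<le> s"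
      "f (z + s *\<^sub>R h + s *\<^sub>R k) - f (z + s *\<^sub>R h) - f (z + s *\<^sub>R k) + f z
        = s\<^sup>2 * dderiv k (dderiv h f) (z + a *\<^sub>R h + b *\<^sub>R k)"
      by (rule second_difference[where f=f and h=h and k=k and S=S and z=z, OF d0 d1 s inS])
    have comm: "z + a *\<^sub>R k + b *\<^sub>R h = z + b *\<^sub>R h + a *\<^sub>R k" for a b
      by simp
    have inS': "z + a *\<^sub>R k + b *\<^sub>R h \<in> S" if "0 \<le> a" "a \<le> s" "0 \<le> b" "b \<le> s" for a b
      using inS[OF that(3,4,1,2)] by (simp only: comm)
    obtain a' b' where ab': "0 \<le> a'" "a' \<le> s" "0 \<le> b'" "b' \<le> s"
      "f (z + s *\<^sub>R k + s *\<^sub>R h) - f (z + s *\<^sub>R k) - f (z + s *\<^sub>R h) + f z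
        = s\<^sup>2 * dderiv h (dderiv k f) (z + a' *\<^sub>R k + b' *\<^sub>R h)"
      by (rule second_difference[where f=f and h=k and k=h and S=S and z=z, OF d0 d1 s inS'])
    have "f (z + s *\<^sub>R k + s *\<^sub>R h) = f (z + s *\<^sub>R h + s *\<^sub>R k)"
      by (simp only: comm)
    then have "s\<^sup>2 * dderiv h (dderiv k f) (z + a' *\<^sub>R k + b' *\<^sub>R h) = s\<^sup>2 * dderiv k (dderiv h f) (z + a *\<^sub>R h + b *\<^sub>R k)"
      using ab(5) ab'(5) by linarith
    then have eq: "dderiv h (dderiv k f) (z + b' *\<^sub>R h + a' *\<^sub>R k) = dderiv k (dderiv h f) (z + a *\<^sub>R h + b *\<^sub>R k)"
      using s by (simp add: comm)
    have "\<bar>dderiv h (dderiv k f) (z + b' *\<^sub>R h + a' *\<^sub>R k) - dderiv h (dderiv k f) z\<bar> < e"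
      using d1'(2) near[OF ab'(3,4,1,2)] by (simp add: \<delta>_def dist_real_def)
    moreover have "\<bar>dderiv k (dderiv h f) (z + a *\<^sub>R h + b *\<^sub>R k) - dderiv k (dderiv h f) z\<bar> < e"
      using d2'(2) near[OF ab(1-4)] by (simp add: \<delta>_def dist_real_def)
    ultimately show False
      using eq by (auto simp: e_def abs_if split: if_splits)
  qed
qed

text \<open>If \<open>c\<close> were positive, \<open>\<psi>\<close> would be positive just to the
  right of its zero at 0, and \<open>\<phi>\<close> would exceed its maximum there by the mean value
  theorem.\<close>

lemma second_derivative_test_max:
  fixes \<phi> :: "real \<Rightarrow> real"
  assumes max: "\<And>s. \<phi> s \<le> \<phi> 0"
    and d: "\<And>s. (\<phi> has_real_derivative \<psi> s) (at s)"
    and dd: "(\<psi> has_real_derivative c) (at 0)"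
  shows "\<psi> 0 = 0" "c \<le> 0"
proof -
  show 0: "\<psi> 0 = 0"
    by (rule DERIV_local_max[OF d, of 1]) (auto simp: max)
  show "c \<le> 0"
  proof (rule ccontr)
    assume "\<not> c \<le> 0"
    then obtain r where r: "r > 0" "\<And>h. h > 0 \<Longrightarrow> h < r \<Longrightarrow> \<psi> 0 < \<psi> (0 + h)"
      using DERIV_pos_inc_right[OF dd] by auto
    obtain z where "0 < z" "z < r/2" "\<phi> (r/2) - \<phi> 0 = (r/2 - 0) * \<psi> z"
      using MVT2[of 0 "r/2" \<phi> \<psi>] d r(1) by auto
    moreover have "\<psi> z > 0" using r(2)[of z] 0 calculation r(1) by auto
    ultimately have "\<phi> (r/2) > \<phi> 0" using r(1) by (smt (verit) mult_pos_pos)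
    then show False using max[of "r/2"] by simp
  qed
qed

section \<open>A maximum principle for periodic functions\<close>

lemma int_lattice_translate_unit_cell:
  fixes x :: "real ^ 'n"
  obtains k where "k \<in> int_lattice" "x + k \<in> cbox 0 1"
proof
  show "(\<chi> i. - of_int \<lfloor>x $ i\<rfloor>) \<in> int_lattice"
    by (simp add: int_lattice_def)
  show "x + (\<chi> i. - of_int \<lfloor>x $ i\<rfloor>) \<in> cbox 0 1"
    by (auto simp: mem_box_cart) linarith+
qed

text \<open>The condition \<open>crit\<close> gives only a nonpositive time derivative. Subtracting
  \<open>e * t\<close> makes it strictly negative, which rules out a maximum at positive time;
  periodicity supplies the compactness for a maximum to exist.\<close>

lemma periodic_maximum_principle:
  fixes f :: "(real ^ 'n) \<times> real \<Rightarrow> real"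
  assumes per: "\<And>x t k. 0 \<le> t \<Longrightarrow> k \<in> int_lattice \<Longrightarrow> f (x + k, t) = f (x, t)"
    and cont: "continuous_on (UNIV \<times> {0..}) f"
    and crit: "\<And>x t. 0 < t \<Longrightarrow> (\<And>y. f (y, t) \<le> f (x, t)) \<Longrightarrow>
       \<exists>D\<le>0. ((\<lambda>s. f (x, s)) has_real_derivative D) (at t)"
    and B: "\<And>x. f (x, 0) \<le> B" and T: "0 \<le> T"
  shows "f (x, T) \<le> B"
proof (rule field_le_epsilon)
  fix \<epsilon> :: real assume \<epsilon>: "0 < \<epsilon>"
  \<comment> \<open>With \<open>T + 1\<close> instead of \<open>T\<close> the quotient also makes
    sense for \<open>T = 0\<close>, and \<open>e * T\<close> stays below
    \<open>\<epsilon>\<close>.\<close>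
  define e where "e = \<epsilon> / (T + 1)"
  have e: "e > 0" "e * T \<le> \<epsilon>" using \<epsilon> T by (auto simp: e_def field_simps)
  define K where "K = (cbox 0 1 :: (real ^ 'n) set) \<times> {0..T}"
  have "compact K" unfolding K_def by (intro compact_Times compact_cbox) auto
  moreover have "K \<noteq> {}"
    using T by (auto simp: K_def interval_eq_empty_cart(2))
  moreover have "continuous_on K f"
    by (rule continuous_on_subset[OF cont]) (auto simp: K_def)
  then have "continuous_on K (\<lambda>z. f z - e * snd z)"
    by (intro continuous_intros)
  ultimately obtain z where z: "z \<in> K" "\<And>w. w \<in> K \<Longrightarrow> f w - e * snd w \<le> f z - e * snd z"
    using continuous_attains_sup[of K "\<lambda>z. f z - e * snd z"] by auto
  obtain x0 t0 where z': "z = (x0, t0)" by force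
  have t0: "0 \<le> t0" "t0 \<le> T" using z z' by (auto simp: K_def)
  \<comment> \<open>Translation into the unit cell turns the maximum over \<open>K\<close> into one
    over all of space, which is what \<open>crit\<close> asks for.\<close>
  have max: "f (y, s) - e * s \<le> f (x0, t0) - e * t0" if s: "0 \<le> s" "s \<le> T" for y s
  proof -
    obtain k where "k \<in> int_lattice" "y + k \<in> cbox 0 1" by (rule int_lattice_translate_unit_cell)
    then show ?thesis using z(2)[of "(y + k, s)"] per[of s k y] s by (auto simp: K_def z')
  qed
  have "t0 = 0"
  proof (rule ccontr)
    assume "t0 \<noteq> 0"
    then have pos: "0 < t0" using t0 by simp
    then obtain D where D: "D \<le> 0" "((\<lambda>s. f (x0, s)) has_real_derivative D) (at t0)"
      using crit[OF pos, of x0] max[OF t0] by auto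
    then have "((\<lambda>s. f (x0, s) - e * s) has_real_derivative D - e) (at t0)"
      by (auto intro!: derivative_eq_intros)
    \<comment> \<open>A negative slope gives larger values at slightly earlier times. Only earlier
      times are compared, so \<open>t0 = T\<close> needs no separate treatment.\<close>
    from DERIV_neg_dec_left[OF this] D e obtain r where r: "r > 0"
      "\<And>h. h > 0 \<Longrightarrow> h < r \<Longrightarrow> f (x0, t0) - e * t0 < f (x0, t0 - h) - e * (t0 - h)"
      by auto
    define h where "h = min (r / 2) t0"
    have "0 < h" "h < r" "h \<le> t0" using r(1) pos by (auto simp: h_def)
    then show False using r(2)[of h] max[of "t0 - h" x0] t0 by auto
  qed
  then show "f (x, T) \<le> B + \<epsilon>"
    using max[of T x] B[of x0] e T by auto
qed

section \<open>Symmetric matrices\<close>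

lemma sym_matsI_bilinear:
  assumes "\<And>\<xi> \<eta>. \<xi> \<bullet> (X *v \<eta>) = \<eta> \<bullet> (X *v \<xi>)"
  shows "X \<in> sym_mats"
proof -
  have "X $ j $ i = X $ i $ j" for i j
    using assms[of "axis i 1" "axis j 1"]
    by (simp add: inner_axis inner_axis' matrix_vector_mult_basis column_def)
  then show ?thesis
    by (simp add: sym_mats_def transpose_def vec_eq_iff)
qed

lemma sym_mats_component: "X \<in> sym_mats \<Longrightarrow> X $ i $ j = X $ j $ i"
  unfolding sym_mats_def transpose_def
  by (metis (mono_tags, lifting) mem_Collect_eq vec_lambda_beta)

lemma sym_mats_inner: "X \<in> sym_mats \<Longrightarrow> (X *v \<xi>) \<bullet> \<eta> = \<xi> \<bullet> (X *v \<eta>)"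
  using dot_lmul_matrix[of \<xi> X \<eta>] transpose_matrix_vector[of X \<xi>]
  by (simp add: sym_mats_def)

lemma sym_mats_subspace: "subspace sym_mats"
  by (auto simp: subspace_def sym_mats_def transpose_def vec_eq_iff)

lemma sym_mats_add: "X \<in> sym_mats \<Longrightarrow> Y \<in> sym_mats \<Longrightarrow> X + Y \<in> sym_mats"
  using sym_mats_subspace by (rule subspace_add)

lemma sym_mats_scaleR: "X \<in> sym_mats \<Longrightarrow> c *\<^sub>R X \<in> sym_mats"
  using sym_mats_subspace by (rule subspace_scale)

lemma sym_mats_diff: "X \<in> sym_mats \<Longrightarrow> Y \<in> sym_mats \<Longrightarrow> X - Y \<in> sym_mats"
  using sym_mats_subspace by (rule subspace_diff)

text \<open>\<open>frob\<close> pairs entry (i,j) with entry (j,i), the Euclidean inner product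
  pairs it with (i,j). Symmetry of one factor reconciles them.\<close>

lemma frob_sym: "H \<in> sym_mats \<Longrightarrow> frob A H = A \<bullet> H"
  by (simp add: frob_def trace_def matrix_matrix_mult_def inner_vec_def sym_mats_component[of H])

section \<open>Gradients and the partial derivatives of \<open>F\<close>\<close>

lemma grad_eq: "GDERIV f x :> g \<Longrightarrow> grad f x = g"
proof -
  assume g: "GDERIV f x :> g"
  have "g' = g" if "GDERIV f x :> g'" for g'
  proof -
    have "(\<lambda>h. h \<bullet> g') = (\<lambda>h. h \<bullet> g)"
      using that g unfolding gderiv_def by (rule has_derivative_unique)
    then show ?thesis by (metis vector_eq_ldot)
  qed
  then show ?thesis
    using g unfolding grad_def by (blast intro: the_equality)
qed

text \<open>Since \<open>E_dom\<close> contains only symmetric matrices, the component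
  \<open>GX\<close> of a gradient given by \<open>Ck_on\<close> is determined only up to an
  antisymmetric part. \<open>D_X\<close> is its symmetrization, and the two agree when paired with
  symmetric \<open>H\<close>.\<close>

lemma
  fixes F :: "('n::finite) point \<Rightarrow> real"
  assumes F: "(F has_derivative (\<lambda>h. (GX, Gp, Gv, Gx, Gt) \<bullet> h)) (at (X, p, v, x, t) within E_dom ul uu M)"
    and E: "(X, p, v, x, t) \<in> E_dom ul uu M" and "ul < uu"
  shows D_X_inner: "H \<in> sym_mats \<Longrightarrow> frob (D_X F (X, p, v, x, t)) H = GX \<bullet> H"
    and D_u_eq: "D_u ul uu F (X, p, v, x, t) = Gv"
    and D_x_eq: "D_x F (X, p, v, x, t) = Gx"
    and D_X_line: "H \<in> sym_mats \<Longrightarrow> ((\<lambda>s. F (X + s *\<^sub>R H, p, v, x, t)) has_real_derivative GX \<bullet> H) (at 0)"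
proof -
  have E': "X \<in> sym_mats" "p \<in> cball 0 M" "v \<in> {ul..uu}" "0 < t"
    using E by (auto simp: E_dom_def)
  \<comment> \<open>The chain rule along a map that stays in \<open>E_dom\<close>. Each partial
    derivative below is the case of a map moving a single variable.\<close>
  have comp: "((\<lambda>y. F (\<phi> y)) has_derivative (\<lambda>h. (GX, Gp, Gv, Gx, Gt) \<bullet> \<phi>' h)) (at a within T)"
    if "(\<phi> has_derivative \<phi>') (at a within T)" "\<phi> a = (X, p, v, x, t)" "\<phi> ` T \<subseteq> E_dom ul uu M"
    for \<phi> \<phi>' T and a :: "'b::real_normed_vector"
    using has_derivative_in_compose[OF that(1), of F] has_derivative_subset[OF F that(3)] that(2) by simp
  show line: "((\<lambda>s. F (X + s *\<^sub>R H, p, v, x, t)) has_real_derivative GX \<bullet> H) (at 0)"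
    if "H \<in> sym_mats" for H
  proof -
    have "((\<lambda>s. F (X + s *\<^sub>R H, p, v, x, t)) has_derivative
        (\<lambda>h. (GX, Gp, Gv, Gx, Gt) \<bullet> (h *\<^sub>R H, 0, 0, 0, 0))) (at 0 within UNIV)"
      by (rule comp) (use E' that in
        \<open>auto intro!: derivative_eq_intros simp: E_dom_def sym_mats_add sym_mats_scaleR zero_prod_def\<close>)
    then show ?thesis
      by (simp add: has_field_derivative_def mult_commute_abs)
  qed
  define A where "A = (1/2) *\<^sub>R (GX + transpose GX)"
  have A: "A \<in> sym_mats"
    by (simp add: A_def sym_mats_def transpose_def vec_eq_iff)
  have tr: "transpose GX \<bullet> H = GX \<bullet> H" if "H \<in> sym_mats" for H
  proof -
    have "transpose GX \<bullet> H = (\<Sum>i\<in>UNIV. \<Sum>j\<in>UNIV. GX $ j $ i * H $ j $ i)"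
      by (simp add: inner_vec_def transpose_def sym_mats_component[OF that])
    also have "\<dots> = GX \<bullet> H"
      unfolding inner_vec_def inner_real_def by (rule sum.swap)
    finally show ?thesis .
  qed
  have AH: "frob A H = GX \<bullet> H" if "H \<in> sym_mats" for H
    using that tr[OF that] by (simp add: frob_sym A_def inner_add_left)
  have "D_X F (X, p, v, x, t) = A"
    unfolding D_X_def prod.case
  proof (rule the_equality)
    have "((\<lambda>Y. F (Y, p, v, x, t)) has_derivative
        (\<lambda>h. (GX, Gp, Gv, Gx, Gt) \<bullet> (h, 0, 0, 0, 0))) (at X within sym_mats)"
      by (rule comp) (use E' in \<open>auto intro!: derivative_eq_intros simp: E_dom_def zero_prod_def\<close>)
    then have "((\<lambda>Y. F (Y, p, v, x, t)) has_derivative (\<lambda>H. GX \<bullet> H)) (at X within sym_mats)"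
      by simp
    moreover have "bounded_linear (frob A)"
      unfolding linear_conv_bounded_linear[symmetric] frob_def
      by (rule linearI) (simp_all add: matrix_add_ldistrib trace_add, simp add: trace_def matrix_matrix_mult_def sum_distrib_left ac_simps)
    \<comment> \<open>A derivative within \<open>sym_mats\<close> sees only increments
      \<open>Y - X\<close>, which are symmetric, so \<open>GX\<close> may be replaced by
      \<open>A\<close>.\<close>
    moreover have "frob A (Y - X) = GX \<bullet> (Y - X)" if "Y \<in> sym_mats" for Y
      using AH[of "Y - X"] that E' sym_mats_diff by blast
    ultimately have "((\<lambda>Y. F (Y, p, v, x, t)) has_derivative (\<lambda>H. frob A H)) (at X within sym_mats)"
      by (auto simp: has_derivative_within_alt)
    then show "A \<in> sym_mats \<and> ((\<lambda>Y. F (Y, p, v, x, t)) has_derivative (\<lambda>H. frob A H)) (at X within sym_mats)"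
      using A by blast
  next
    fix B assume B: "B \<in> sym_mats \<and> ((\<lambda>Y. F (Y, p, v, x, t)) has_derivative (\<lambda>H. frob B H)) (at X within sym_mats)"
    \<comment> \<open>For uniqueness, both candidates are compared along the line through
      \<open>X\<close> in direction \<open>B - A\<close>, which stays in \<open>sym_mats\<close>.
      Equal slopes force \<open>H\<close> to be orthogonal to itself.\<close>
    define H where "H = B - A"
    have H: "H \<in> sym_mats" using A B sym_mats_diff H_def by blast
    have img: "(\<lambda>s. X + s *\<^sub>R H) ` UNIV \<subseteq> sym_mats"
      using E' H by (auto simp: sym_mats_add sym_mats_scaleR)
    have l: "((\<lambda>s. X + s *\<^sub>R H) has_derivative (\<lambda>s. s *\<^sub>R H)) (at 0 within UNIV)"
      by (auto intro!: derivative_eq_intros)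
    have "((\<lambda>s. F (X + s *\<^sub>R H, p, v, x, t)) has_derivative (\<lambda>s. frob B (s *\<^sub>R H))) (at 0)"
      using has_derivative_in_compose[OF l, of "\<lambda>Y. F (Y, p, v, x, t)" "frob B"]
        has_derivative_subset[OF conjunct2[OF B] img] by simp
    moreover have "((\<lambda>s. F (X + s *\<^sub>R H, p, v, x, t)) has_derivative (\<lambda>s. s * (GX \<bullet> H))) (at 0)"
      using line[OF H] by (simp add: has_field_derivative_def mult_commute_abs)
    ultimately have "(\<lambda>s. frob B (s *\<^sub>R H)) = (\<lambda>s. s * (GX \<bullet> H))"
      by (rule has_derivative_unique)
    from fun_cong[OF this, of 1] have "frob B H = frob A H"
      using AH[OF H] by simp
    then have "H \<bullet> H = 0"
      using H by (simp add: frob_sym H_def inner_diff_left)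
    then show "B = A" by (simp add: H_def)
  qed
  then show "H \<in> sym_mats \<Longrightarrow> frob (D_X F (X, p, v, x, t)) H = GX \<bullet> H" for H
    using AH by simp
  have "((\<lambda>w. F (X, p, w, x, t)) has_derivative
      (\<lambda>h. (GX, Gp, Gv, Gx, Gt) \<bullet> (0, 0, h, 0, 0))) (at v within {ul..uu})"
    by (rule comp) (use E' in \<open>auto intro!: derivative_eq_intros simp: E_dom_def zero_prod_def\<close>)
  then have "((\<lambda>w. F (X, p, w, x, t)) has_vector_derivative Gv) (at v within cbox ul uu)"
    by (simp add: has_vector_derivative_def mult_commute_abs)
  \<comment> \<open>Because \<open>ul < uu\<close>, the derivative within the interval is unique,
    also at its end points.\<close>
  then show "D_u ul uu F (X, p, v, x, t) = Gv"
    using vector_derivative_within_cbox[of ul uu v "\<lambda>w. F (X, p, w, x, t)" Gv] \<open>ul < uu\<close> E'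
    by (simp add: D_u_def)
  have "((\<lambda>y. F (X, p, v, y, t)) has_derivative
      (\<lambda>h. (GX, Gp, Gv, Gx, Gt) \<bullet> (0, 0, 0, h, 0))) (at x within UNIV)"
    by (rule comp) (use E' in \<open>auto intro!: derivative_eq_intros simp: E_dom_def zero_prod_def\<close>)
  then have "GDERIV (\<lambda>y. F (X, p, v, y, t)) x :> Gx"
    by (simp add: gderiv_def inner_commute)
  then show "D_x F (X, p, v, x, t) = Gx"
    by (simp add: D_x_def grad_eq)
qed

section \<open>Derivatives of the solution in space and time\<close>

lemma
  fixes u :: "(real ^ 'n) \<times> real \<Rightarrow> real"
  assumes "Ck_on (Suc k) (UNIV \<times> {0..}) u"
  shows spatial_grad_has_derivative: "0 \<le> t \<Longrightarrow>
      ((\<lambda>y. u (y, t)) has_derivative (\<lambda>h. grad (\<lambda>y. u (y, t)) x \<bullet> h)) (at x)"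
    and spatial_grad_continuous: "continuous_on (UNIV \<times> {0..}) (\<lambda>z. grad (\<lambda>y. u (y, snd z)) (fst z))"
proof -
  obtain G where G: "\<And>z. z \<in> UNIV \<times> {0..} \<Longrightarrow> (u has_derivative (\<lambda>h. G z \<bullet> h)) (at z within UNIV \<times> {0..})"
     and Gb: "\<And>b. b \<in> Basis \<Longrightarrow> Ck_on k (UNIV \<times> {0..}) (\<lambda>z. G z \<bullet> b)"
    using assms unfolding Ck_on.simps(2) by blast
  have "continuous_on (UNIV \<times> {0..}) (\<lambda>z. G z \<bullet> b)" if "b \<in> Basis" for b
    using Ck_on_mono[OF Gb[OF that], of 0] by simp
  then have Gc: "continuous_on (UNIV \<times> {0..}) G"
    using continuous_on_componentwise by blast
  \<comment> \<open>A slice of constant time lies entirely in the closed half-space, so the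
    derivative within it restricts to a full spatial derivative, even at time 0.\<close>
  have D: "((\<lambda>y. u (y, t)) has_derivative (\<lambda>h. fst (G (x, t)) \<bullet> h)) (at x)" if "0 \<le> t" for x t
  proof -
    have "((\<lambda>y. (y, t)) has_derivative (\<lambda>h. (h, 0))) (at x within UNIV)"
      by (auto intro!: derivative_eq_intros)
    moreover have "(u has_derivative (\<lambda>h. G (x, t) \<bullet> h)) (at (x, t) within (\<lambda>y. (y, t)) ` UNIV)"
      by (rule has_derivative_subset[OF G]) (use that in auto)
    ultimately have "((\<lambda>y. u (y, t)) has_derivative (\<lambda>h. G (x, t) \<bullet> (h, 0))) (at x within UNIV)"
      by (rule has_derivative_in_compose)
    then show ?thesis
      by (simp add: inner_prod_def)
  qed
  then have eq: "grad (\<lambda>y. u (y, t)) x = fst (G (x, t))" if "0 \<le> t" for x t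
    using that by (intro grad_eq) (simp add: gderiv_def inner_commute)
  show "0 \<le> t \<Longrightarrow> ((\<lambda>y. u (y, t)) has_derivative (\<lambda>h. grad (\<lambda>y. u (y, t)) x \<bullet> h)) (at x)"
    using D eq by simp
  have "continuous_on (UNIV \<times> {0..}) (\<lambda>z. fst (G z))"
    by (intro continuous_on_fst Gc)
  then show "continuous_on (UNIV \<times> {0..}) (\<lambda>z. grad (\<lambda>y. u (y, snd z)) (fst z))"
    by (rule continuous_on_eq) (auto simp: eq)
qed

lemma dderiv_slice:
  fixes f :: "(real ^ 'n) \<times> real \<Rightarrow> real"
  assumes "f differentiable (at (x, t))"
  shows "((\<lambda>y. f (y, t)) has_derivative (\<lambda>h. dderiv (h, 0) f (x, t))) (at x)"
  by (rule has_derivative_compose[where f = "\<lambda>y. (y, t)", OF _ assms[unfolded frechet_derivative_works]])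
     (auto intro!: derivative_eq_intros)

lemma bounded_linear_inner_matrix: "bounded_linear (\<lambda>X. \<xi> \<bullet> ((X :: real ^ 'n ^ 'm) *v \<eta>))"
  unfolding linear_conv_bounded_linear[symmetric]
  by (rule linearI) (simp_all add: matrix_vector_mult_add_rdistrib inner_add_right scaleR_matrix_vector_assoc[symmetric])

lemma dderiv_cong:
  assumes "open S" "z \<in> S" "\<And>w. w \<in> S \<Longrightarrow> f w = g w" "f differentiable (at z)"
  shows "dderiv h f z = dderiv h g z"
  using frechet_derivative_transform_within_open[OF assms(4,1,2,3)] by simp

context
  fixes u :: "(real ^ 'n::finite) \<times> real \<Rightarrow> real" and S :: "((real ^ 'n) \<times> real) set"
  assumes C3: "Ck_on 3 (UNIV \<times> {0..}) u" and S_def: "S = UNIV \<times> {0<..}"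
begin

lemma open_S: "open S"
  by (simp add: S_def open_Times)

lemma C3_S: "Ck_on 3 S u"
  by (rule Ck_on_subset[OF C3]) (auto simp: S_def)

lemma C2_S: "Ck_on 2 S u"
  by (rule Ck_on_mono[OF C3_S]) simp

lemma C2_d: "Ck_on 2 S (dderiv h u)"
  using Ck_on_dderiv[of 2 S u h] C3_S open_S by (simp add: eval_nat_numeral del: Ck_on.simps)

lemma C1_dd: "Ck_on 1 S (dderiv k (dderiv h u))"
  using Ck_on_dderiv[of 1 S "dderiv h u" k] C2_d[of h] open_S by (simp add: eval_nat_numeral del: Ck_on.simps)

lemma diff_u: "z \<in> S \<Longrightarrow> u differentiable (at z)"
  using Ck_on_imp_differentiable[of 2 S u] C3_S open_S by (simp add: eval_nat_numeral del: Ck_on.simps)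

lemma diff_d: "z \<in> S \<Longrightarrow> dderiv h u differentiable (at z)"
  using Ck_on_imp_differentiable[of 1 S "dderiv h u"] C2_d[of h] open_S by (simp add: eval_nat_numeral del: Ck_on.simps)

lemma diff_dd: "z \<in> S \<Longrightarrow> dderiv k (dderiv h u) differentiable (at z)"
  using Ck_on_imp_differentiable[of 0 S "dderiv k (dderiv h u)"] C1_dd[where k = k and h = h] open_S
  by (simp add: eval_nat_numeral del: Ck_on.simps)

lemma grad_inner:
  assumes "0 < t"
  shows "grad (\<lambda>y. u (y, t)) x \<bullet> \<xi> = dderiv (\<xi>, 0) u (x, t)"
proof -
  have "((\<lambda>y. u (y, t)) has_derivative (\<lambda>h. grad (\<lambda>y. u (y, t)) x \<bullet> h)) (at x)"
    using spatial_grad_has_derivative[of 2 u] C3 assms by (simp add: eval_nat_numeral del: Ck_on.simps)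
  from has_derivative_unique[OF this dderiv_slice[OF diff_u]] assms show ?thesis
    by (auto simp: S_def fun_eq_iff)
qed

text \<open>Differentiability of the spatial gradient jointly in space and time: the spatial part of
  \<open>K\<close> yields the Hessian, the temporal part the evolution of the gradient.\<close>

lemma grad_has_derivative:
  assumes "0 < t"
  obtains K where "((\<lambda>z. grad (\<lambda>y. u (y, snd z)) (fst z)) has_derivative K) (at (x, t))"
    "\<And>h \<xi>. K h \<bullet> \<xi> = dderiv h (dderiv (\<xi>, 0) u) (x, t)"
proof -
  let ?g = "\<lambda>z. grad (\<lambda>y. u (y, snd z)) (fst z)"
  have z: "(x, t) \<in> S" using assms by (simp add: S_def)
  have g: "((\<lambda>z. ?g z \<bullet> \<xi>) has_derivative (\<lambda>h. dderiv h (dderiv (\<xi>, 0) u) (x, t))) (at (x, t))" for \<xi>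
    by (rule has_derivative_transform_within_open[OF diff_d[OF z, unfolded frechet_derivative_works] open_S z])
       (auto simp: grad_inner S_def)
  \<comment> \<open>The derivative is assembled from basis components. The formula for arbitrary
    \<open>\<xi>\<close> then follows from uniqueness of derivatives.\<close>
  define K where "K h = (\<Sum>b\<in>Basis. dderiv h (dderiv (b, 0) u) (x, t) *\<^sub>R b)" for h
  have Kb: "K h \<bullet> b = dderiv h (dderiv (b, 0) u) (x, t)" if "b \<in> Basis" for h b
    using that by (simp add: K_def inner_sum_left inner_Basis if_distrib[of "\<lambda>c. _ * c"] cong: if_cong)
  have K: "(?g has_derivative K) (at (x, t))"
    unfolding has_derivative_componentwise_within[of ?g] using g Kb by simp
  moreover have "K h \<bullet> \<xi> = dderiv h (dderiv (\<xi>, 0) u) (x, t)" for h \<xi>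
    using has_derivative_unique[OF has_derivative_inner_left[OF K, of \<xi>] g] by (rule fun_cong)
  ultimately show ?thesis by (rule that)
qed

lemma
  assumes "0 < t"
  shows grad_slice: "((\<lambda>y. grad (\<lambda>y. u (y, t)) y) has_derivative (\<lambda>h. hess (\<lambda>y. u (y, t)) x *v h)) (at x)"
    and hess_inner: "\<xi> \<bullet> (hess (\<lambda>y. u (y, t)) x *v \<eta>) = dderiv (\<eta>, 0) (dderiv (\<xi>, 0) u) (x, t)"
proof -
  obtain K where K: "((\<lambda>z. grad (\<lambda>y. u (y, snd z)) (fst z)) has_derivative K) (at (x, t))"
    "\<And>h \<xi>. K h \<bullet> \<xi> = dderiv h (dderiv (\<xi>, 0) u) (x, t)"
    using grad_has_derivative[OF assms] by blast
  have "((\<lambda>y. (y, t)) has_derivative (\<lambda>h. (h, 0))) (at x)"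
    by (auto intro!: derivative_eq_intros)
  then have "((\<lambda>y. grad (\<lambda>y. u (y, t)) y) has_derivative (\<lambda>h. K (h, 0))) (at x)"
    using has_derivative_compose[where f = "\<lambda>y. (y, t)" and f' = "\<lambda>h. (h, 0)" and x = x and s = UNIV
        and g = "\<lambda>z. grad (\<lambda>y. u (y, snd z)) (fst z)" and g' = K] K(1) by simp
  \<comment> \<open>\<open>hess\<close> is a \<open>jacobian\<close>, which represents the
    derivative once differentiability is known.\<close>
  moreover from this have "grad (\<lambda>y. u (y, t)) differentiable (at x)"
    by (auto simp: differentiable_def)
  then show *: "((\<lambda>y. grad (\<lambda>y. u (y, t)) y) has_derivative (\<lambda>h. hess (\<lambda>y. u (y, t)) x *v h)) (at x)"
    by (simp add: jacobian_works hess_def)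
  ultimately have "(\<lambda>h. K (h, 0)) = (\<lambda>h. hess (\<lambda>y. u (y, t)) x *v h)"
    by (blast intro: has_derivative_unique)
  then show "\<xi> \<bullet> (hess (\<lambda>y. u (y, t)) x *v \<eta>) = dderiv (\<eta>, 0) (dderiv (\<xi>, 0) u) (x, t)"
    using K(2)[of "(\<eta>, 0)" \<xi>] by (simp add: fun_eq_iff inner_commute)
qed

lemma hess_sym: "0 < t \<Longrightarrow> hess (\<lambda>y. u (y, t)) x \<in> sym_mats"
  using dderiv_commute[OF C2_S open_S]
  by (intro sym_matsI_bilinear) (simp add: hess_inner S_def)

text \<open>Third derivatives enter as the derivative \<open>Y\<close> of the Hessian. It is built
  entry by entry and read as a bilinear form in \<open>\<xi>\<close> and \<open>\<eta>\<close> by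
  uniqueness of derivatives.\<close>

lemma hess_has_derivative:
  assumes "0 < t"
  obtains Y where "((\<lambda>y. hess (\<lambda>y. u (y, t)) y) has_derivative Y) (at x)"
    "\<And>h \<xi> \<eta>. \<xi> \<bullet> (Y h *v \<eta>) = dderiv (h, 0) (dderiv (\<eta>, 0) (dderiv (\<xi>, 0) u)) (x, t)"
    "\<And>h. Y h \<in> sym_mats"
proof -
  let ?H = "\<lambda>y. hess (\<lambda>y. u (y, t)) y"
  have z: "(x, t) \<in> S" using assms by (simp add: S_def)
  have g: "((\<lambda>y. \<xi> \<bullet> (?H y *v \<eta>)) has_derivative
      (\<lambda>h. dderiv (h, 0) (dderiv (\<eta>, 0) (dderiv (\<xi>, 0) u)) (x, t))) (at x)" for \<xi> \<eta>
    using dderiv_slice[OF diff_dd[OF z]] assms by (simp add: hess_inner)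
  define Y where "Y h = (\<chi> i j. dderiv (h, 0) (dderiv (axis j 1, 0) (dderiv (axis i 1, 0) u)) (x, t))" for h
  have comp: "X \<bullet> axis i (axis j 1) = axis i 1 \<bullet> (X *v axis j 1)" for X :: "real ^ 'n ^ 'n" and i j
    by (simp add: inner_axis inner_axis' matrix_vector_mult_basis column_def)
  have Y: "(?H has_derivative Y) (at x)"
    unfolding has_derivative_componentwise_within[of ?H]
  proof
    fix b :: "real ^ 'n ^ 'n" assume "b \<in> Basis"
    then obtain i j where b: "b = axis i (axis j 1)"
      by (auto simp: Basis_vec_def)
    have "Y h \<bullet> b = dderiv (h, 0) (dderiv (axis j 1, 0) (dderiv (axis i 1, 0) u)) (x, t)" for h
      by (simp add: b inner_axis Y_def)
    then show "((\<lambda>y. ?H y \<bullet> b) has_derivative (\<lambda>h. Y h \<bullet> b)) (at x)"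
      using g by (simp only: b comp)
  qed
  moreover have Y2: "\<xi> \<bullet> (Y h *v \<eta>) = dderiv (h, 0) (dderiv (\<eta>, 0) (dderiv (\<xi>, 0) u)) (x, t)" for h \<xi> \<eta>
    using has_derivative_unique[OF bounded_linear.has_derivative[OF bounded_linear_inner_matrix Y] g]
    by (simp add: fun_eq_iff)
  \<comment> \<open>The inner two derivatives commute on all of \<open>S\<close>, not merely at one
    point, so the identity can be differentiated in direction \<open>h\<close>.\<close>
  moreover have "Y h \<in> sym_mats" for h
    using dderiv_cong[OF open_S z dderiv_commute[OF C2_S open_S] diff_dd[OF z]]
    by (intro sym_matsI_bilinear) (simp only: Y2)
  ultimately show ?thesis by (rule that)
qed

end

section \<open>The sign of the time derivative at a spatial maximum\<close>

lemma sym_mats_square: "X \<in> sym_mats \<Longrightarrow> X ** X \<in> sym_mats"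
  by (simp add: sym_mats_def matrix_transpose_mul)

text \<open>The matrix \<open>- (Y + X ** X)\<close> is positive semidefinite, and \<open>GX\<close>
  is nonnegative on such directions. Hence \<open>GX \<bullet> Y\<close> is at most
  \<open>- (GX \<bullet> (X ** X))\<close>, and the structure condition \<open>str\<close> bounds
  the rest.\<close>

lemma linearized_sign:
  fixes F :: "('n::finite) point \<Rightarrow> real"
  assumes F: "(F has_derivative (\<lambda>h. (GX, Gp, Gv, Gx, Gt) \<bullet> h)) (at (X, p, v, x, t) within E_dom ul uu M)"
    and E: "(X, p, v, x, t) \<in> E_dom ul uu M" and "ul < uu"
    and elliptic: "\<And>Y. Y \<in> sym_mats \<Longrightarrow> mat_le X Y \<Longrightarrow> F (X, p, v, x, t) \<le> F (Y, p, v, x, t)"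
    and str: "- frob (D_X F (X, p, v, x, t)) (X ** X) + (norm p)\<^sup>2 * D_u ul uu F (X, p, v, x, t)
            + D_x F (X, p, v, x, t) \<bullet> p \<le> 0"
    and Y: "Y \<in> sym_mats" "\<And>\<xi>. \<xi> \<bullet> ((Y + X ** X) *v \<xi>) \<le> 0"
  shows "GX \<bullet> Y + Gv * (norm p)\<^sup>2 + Gx \<bullet> p \<le> 0"
proof -
  note D = D_X_inner[OF F E \<open>ul < uu\<close>] D_u_eq[OF F E \<open>ul < uu\<close>] D_x_eq[OF F E \<open>ul < uu\<close>]
  have X: "X \<in> sym_mats" using E by (auto simp: E_dom_def)
  define Z where "Z = - (Y + X ** X)"
  have Z: "Z \<in> sym_mats"
    using sym_mats_scaleR[OF sym_mats_add[OF Y(1) sym_mats_square[OF X]], of "-1"] by (simp add: Z_def)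
  \<comment> \<open>Otherwise a small step from \<open>X\<close> along \<open>Z\<close> would lower
    \<open>F\<close> while raising the matrix, against ellipticity.\<close>
  have "0 \<le> GX \<bullet> Z"
  proof (rule ccontr)
    assume "\<not> 0 \<le> GX \<bullet> Z"
    then obtain r where r: "r > 0"
      "\<And>s. 0 < s \<Longrightarrow> s < r \<Longrightarrow> F (X + s *\<^sub>R Z, p, v, x, t) < F (X, p, v, x, t)"
      using DERIV_neg_dec_right[OF D_X_line[OF F E \<open>ul < uu\<close> Z]] by auto
    have "mat_le X (X + (r/2) *\<^sub>R Z)"
    proof (unfold mat_le_def, rule allI)
      fix \<xi>
      have "\<xi> \<bullet> (Z *v \<xi>) = - (\<xi> \<bullet> ((Y + X ** X) *v \<xi>))"
        using scaleR_matrix_vector_assoc[of "-1" "Y + X ** X" \<xi>, symmetric] by (simp add: Z_def del: minus_add_distrib)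
      then have "0 \<le> \<xi> \<bullet> (Z *v \<xi>)" using Y(2)[of \<xi>] by simp
      then show "0 \<le> \<xi> \<bullet> ((X + (r/2) *\<^sub>R Z - X) *v \<xi>)"
        using r(1) by (simp add: scaleR_matrix_vector_assoc[symmetric])
    qed
    moreover have "X + (r/2) *\<^sub>R Z \<in> sym_mats"
      by (intro sym_mats_add sym_mats_scaleR X Z)
    ultimately show False
      using elliptic[of "X + (r/2) *\<^sub>R Z"] r(1) r(2)[of "r/2"] by simp
  qed
  then have "GX \<bullet> Y + GX \<bullet> (X ** X) \<le> 0"
    by (simp add: Z_def inner_diff_right inner_add_right)
  then show ?thesis
    using str D(1)[OF sym_mats_square[OF X]] by (simp add: D(2,3) mult.commute)
qed

lemma grad_norm_critical:
  fixes F :: "('n::finite) point \<Rightarrow> real" and u :: "(real ^ 'n) \<times> real \<Rightarrow> real"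
  defines "g \<equiv> \<lambda>t y. grad (\<lambda>y. u (y, t)) y"
  assumes C3: "Ck_on 3 (UNIV \<times> {0..}) u"
    and F_C1: "Ck_on 1 (E_dom ul uu M) F" and "ul < uu"
    and F_elliptic: "\<And>X Y p v x t. X \<in> sym_mats \<Longrightarrow> Y \<in> sym_mats \<Longrightarrow> p \<in> cball 0 M \<Longrightarrow>
          v \<in> {ul..uu} \<Longrightarrow> 0 < t \<Longrightarrow> mat_le X Y \<Longrightarrow> F (X, p, v, x, t) \<le> F (Y, p, v, x, t)"
    and F_structure: "\<And>X p v x t. (X, p, v, x, t) \<in> E_dom ul uu M \<Longrightarrow> X *v p = 0 \<Longrightarrow>
          - frob (D_X F (X, p, v, x, t)) (X ** X) + (norm p)\<^sup>2 * D_u ul uu F (X, p, v, x, t)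
            + D_x F (X, p, v, x, t) \<bullet> p \<le> 0"
    and u_eq: "\<And>x t. 0 < t \<Longrightarrow> ((\<lambda>s. u (x, s)) has_real_derivative
          F (hess (\<lambda>y. u (y, t)) x, grad (\<lambda>y. u (y, t)) x, u (x, t), x, t)) (at t)"
    and u_range: "\<And>x t. 0 \<le> t \<Longrightarrow> ul \<le> u (x, t) \<and> u (x, t) \<le> uu"
    and g_bound: "\<And>x t. 0 \<le> t \<Longrightarrow> norm (g t x) \<le> M"
    and t: "0 < t" and max: "\<And>y. (norm (g t y))\<^sup>2 \<le> (norm (g t x))\<^sup>2"
  shows "\<exists>D\<le>0. ((\<lambda>s. (norm (g s x))\<^sup>2) has_real_derivative D) (at t)"
proof -
  define S where "S = (UNIV :: (real ^ 'n) set) \<times> {0::real<..}"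
  have z: "(x, t) \<in> S" using t by (simp add: S_def)
  define H where "H y = hess (\<lambda>y. u (y, t)) y" for y
  define p where "p = g t x"
  have gd: "(g t has_derivative (\<lambda>h. H y *v h)) (at y)" for y
    using grad_slice[OF C3 S_def t] by (simp add: g_def H_def)
  have Hs: "H y \<in> sym_mats" for y
    using hess_sym[OF C3 S_def t] by (simp add: H_def)
  obtain Y where Y: "(H has_derivative Y) (at x)"
    "\<And>h \<xi> \<eta>. \<xi> \<bullet> (Y h *v \<eta>) = dderiv (h, 0) (dderiv (\<eta>, 0) (dderiv (\<xi>, 0) u)) (x, t)"
    "\<And>h. Y h \<in> sym_mats"
    using hess_has_derivative[OF C3 S_def t, of x] unfolding H_def by blast
  \<comment> \<open>Symmetry of the matrix \<open>Y \<xi>\<close> moves \<open>p\<close> into the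
    middle derivative, and commuting the outer two derivatives moves it to the outermost
    place.\<close>
  have swap: "p \<bullet> (Y \<xi> *v \<xi>) = \<xi> \<bullet> (Y p *v \<xi>)" for \<xi>
  proof -
    have "p \<bullet> (Y \<xi> *v \<xi>) = \<xi> \<bullet> (Y \<xi> *v p)"
      using sym_mats_inner[OF Y(3), of \<xi> p \<xi>] by (simp add: inner_commute)
    also have "\<dots> = \<xi> \<bullet> (Y p *v \<xi>)"
      unfolding Y(2) by (rule dderiv_commute[OF C2_d[OF C3 S_def] open_S[OF C3 S_def] z])
    finally show ?thesis .
  qed
  have line: "((\<lambda>s. x + s *\<^sub>R \<xi>) has_derivative (\<lambda>r. r *\<^sub>R \<xi>)) (at s)" for s \<xi>
    by (auto intro!: derivative_eq_intros)
  have gl: "((\<lambda>s. g t (x + s *\<^sub>R \<xi>)) has_vector_derivative H (x + s *\<^sub>R \<xi>) *v \<xi>) (at s)" for s \<xi>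
    using has_derivative_compose[OF line gd] by (simp add: has_vector_derivative_def matrix_vector_mult_scaleR)
  have Hl: "((\<lambda>s. H (x + s *\<^sub>R \<xi>) *v \<xi>) has_vector_derivative Y \<xi> *v \<xi>) (at 0)" for \<xi>
  proof -
    have "((\<lambda>s. H (x + s *\<^sub>R \<xi>)) has_derivative (\<lambda>r. Y (r *\<^sub>R \<xi>))) (at 0)"
      using has_derivative_compose[OF line[of \<xi> 0], of H Y] Y(1) by simp
    then have "((\<lambda>s. H (x + s *\<^sub>R \<xi>)) has_vector_derivative Y \<xi>) (at 0)"
      using has_derivative_linear[OF Y(1)] by (simp add: has_vector_derivative_def linear_cmul)
    moreover have "bounded_linear (\<lambda>A :: real ^ 'n ^ 'n. A *v \<xi>)"
      unfolding linear_conv_bounded_linear[symmetric]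
      by (rule linearI) (simp_all add: matrix_vector_mult_add_rdistrib scaleR_matrix_vector_assoc[symmetric])
    ultimately show ?thesis
      using bounded_linear.has_vector_derivative by blast
  qed
  \<comment> \<open>Along the line through \<open>x\<close> in direction \<open>\<xi>\<close>, the
    squared gradient norm has first derivative 2 p.(H xi) and second derivative 2 (|H xi|^2 +
    p.(Y(xi) xi)) at \<open>x\<close>. By \<open>swap\<close>, the latter is twice the quadratic
    form of \<open>Y p + H x ** H x\<close>.\<close>
  have test: "p \<bullet> (H x *v \<xi>) = 0" "\<xi> \<bullet> ((Y p + H x ** H x) *v \<xi>) \<le> 0" for \<xi>
  proof -
    define \<phi> where "\<phi> s = (norm (g t (x + s *\<^sub>R \<xi>)))\<^sup>2" for s
    define \<psi> where "\<psi> s = 2 * (g t (x + s *\<^sub>R \<xi>) \<bullet> (H (x + s *\<^sub>R \<xi>) *v \<xi>))" for s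
    have "\<phi> s \<le> \<phi> 0" for s using max by (simp add: \<phi>_def)
    moreover have "(\<phi> has_real_derivative \<psi> s) (at s)" for s
      unfolding \<phi>_def \<psi>_def power2_norm_eq_inner has_real_derivative_iff_has_vector_derivative
      by (rule has_vector_derivative_eq_rhs[OF bounded_bilinear.has_vector_derivative[OF bounded_bilinear_inner gl gl]])
         (simp add: inner_commute)
    moreover have "(\<psi> has_real_derivative 2 * ((H x *v \<xi>) \<bullet> (H x *v \<xi>) + p \<bullet> (Y \<xi> *v \<xi>))) (at 0)"
      unfolding \<psi>_def
      by (rule DERIV_cmult, unfold has_real_derivative_iff_has_vector_derivative,
          rule has_vector_derivative_eq_rhs[OF bounded_bilinear.has_vector_derivative[OF bounded_bilinear_inner gl Hl]])
         (simp add: p_def)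
    ultimately have *: "\<psi> 0 = 0" "2 * ((H x *v \<xi>) \<bullet> (H x *v \<xi>) + p \<bullet> (Y \<xi> *v \<xi>)) \<le> 0"
      by (rule second_derivative_test_max)+
    show "p \<bullet> (H x *v \<xi>) = 0" using *(1) by (simp add: \<psi>_def p_def)
    have "\<xi> \<bullet> ((H x ** H x) *v \<xi>) = (H x *v \<xi>) \<bullet> (H x *v \<xi>)"
      using sym_mats_inner[OF Hs] by (simp add: matrix_vector_mul_assoc[symmetric])
    then show "\<xi> \<bullet> ((Y p + H x ** H x) *v \<xi>) \<le> 0"
      using *(2) swap by (simp add: matrix_vector_mult_add_rdistrib inner_add_right)
  qed
  \<comment> \<open>The direction \<open>H x *v p\<close> turns the first-order condition into
    vanishing of its squared norm.\<close>
  have Hp: "H x *v p = 0"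
    using test(1)[of "H x *v p"] sym_mats_inner[OF Hs, of x p "H x *v p"] by simp
  obtain K where K: "((\<lambda>z. grad (\<lambda>y. u (y, snd z)) (fst z)) has_derivative K) (at (x, t))"
    "\<And>h \<xi>. K h \<bullet> \<xi> = dderiv h (dderiv (\<xi>, 0) u) (x, t)"
    using grad_has_derivative[OF C3 S_def t] by blast
  have Kl: "h *\<^sub>R K (0, 1) = K (0, h)" for h
    using linear_cmul[OF has_derivative_linear[OF K(1)], of h "(0, 1)"] by simp
  have "((\<lambda>s. (x, s)) has_derivative (\<lambda>h. (0, h))) (at t)"
    by (auto intro!: derivative_eq_intros)
  from has_derivative_compose[OF this K(1)]
  have gt: "((\<lambda>s. g s x) has_vector_derivative K (0, 1)) (at t)"
    by (simp add: has_vector_derivative_def g_def Kl)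
  \<comment> \<open>The equation is stated for all \<open>y\<close> because it is differentiated in
    space below.\<close>
  have ut: "dderiv (0, 1) u (y, t) = F (H y, g t y, u (y, t), y, t)" for y
  proof -
    have "((\<lambda>r. u ((y, 0) + r *\<^sub>R (0, 1))) has_real_derivative dderiv (0, 1) u ((y, 0) + t *\<^sub>R (0, 1))) (at t)"
      by (rule dderiv_line) (use diff_u[OF C3 S_def] t in \<open>simp add: S_def\<close>)
    then show ?thesis
      using DERIV_unique[OF _ u_eq[OF t, of y]] by (simp add: H_def g_def)
  qed
  let ?\<Phi> = "\<lambda>y. (H y, g t y, u (y, t), y, t)"
  have E: "?\<Phi> y \<in> E_dom ul uu M" for y
    using Hs g_bound[of t y] u_range[of t y] t by (auto simp: E_dom_def)
  obtain GX Gp Gv Gx Gt where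
    G: "(F has_derivative (\<lambda>h. (GX, Gp, Gv, Gx, Gt) \<bullet> h)) (at (?\<Phi> x) within E_dom ul uu M)"
    using F_C1 E[of x] by (auto simp: One_nat_def simp del: inner_Pair) (metis prod_cases5)
  have \<Phi>: "(?\<Phi> has_derivative (\<lambda>h. (Y h, H x *v h, p \<bullet> h, h, 0))) (at x)"
  proof -
    have "((\<lambda>y. u (y, t)) has_derivative (\<lambda>h. p \<bullet> h)) (at x)"
      using spatial_grad_has_derivative[of 2 u t x] C3 t by (simp add: eval_nat_numeral p_def g_def del: Ck_on.simps)
    then show ?thesis
      by (intro has_derivative_Pair Y(1) gd has_derivative_ident has_derivative_const)
  qed
  \<comment> \<open>The point may lie on the boundary of \<open>E_dom\<close>, with |p| = M or
    \<open>u\<close> equal to \<open>ul\<close> or \<open>uu\<close>. The chain rule still applies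
    because \<open>?\<Phi>\<close> takes all its values in \<open>E_dom\<close>.\<close>
  have "((\<lambda>y. F (?\<Phi> y)) has_derivative (\<lambda>h. (GX, Gp, Gv, Gx, Gt) \<bullet> (Y h, H x *v h, p \<bullet> h, h, 0))) (at x within UNIV)"
    by (rule has_derivative_in_compose[OF \<Phi>]) (rule has_derivative_subset[OF G], use E in auto)
  moreover have "((\<lambda>y. F (?\<Phi> y)) has_derivative (\<lambda>h. dderiv (h, 0) (dderiv (0, 1) u) (x, t))) (at x)"
    using dderiv_slice[OF diff_d[OF C3 S_def z, of "(0, 1)"]] by (simp only: ut)
  ultimately have "(\<lambda>h. (GX, Gp, Gv, Gx, Gt) \<bullet> (Y h, H x *v h, p \<bullet> h, h, 0)) =
      (\<lambda>h. dderiv (h, 0) (dderiv (0, 1) u) (x, t))"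
    by (intro has_derivative_unique) auto
  \<comment> \<open>In direction \<open>p\<close> the \<open>Gp\<close> term vanishes by
    \<open>Hp\<close>.\<close>
  from fun_cong[OF this, of p]
  have "dderiv (p, 0) (dderiv (0, 1) u) (x, t) = GX \<bullet> Y p + Gv * (norm p)\<^sup>2 + Gx \<bullet> p"
    by (simp add: Hp power2_norm_eq_inner)
  \<comment> \<open>Exchanging the time derivative with the derivative in direction \<open>p\<close>
    identifies half the time derivative of the squared gradient norm with the differentiated
    equation.\<close>
  moreover have "K (0, 1) \<bullet> p = dderiv (p, 0) (dderiv (0, 1) u) (x, t)"
    unfolding K(2) by (rule dderiv_commute[OF C2_S[OF C3 S_def] open_S[OF C3 S_def] z])
  moreover have "GX \<bullet> Y p + Gv * (norm p)\<^sup>2 + Gx \<bullet> p \<le> 0"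
  proof (rule linearized_sign[OF G[folded p_def] E[of x, folded p_def] \<open>ul < uu\<close>])
    show "F (H x, p, u (x, t), x, t) \<le> F (Z, p, u (x, t), x, t)" if "Z \<in> sym_mats" "mat_le (H x) Z" for Z
      using F_elliptic[OF Hs that(1) _ _ t that(2)] E[of x] by (simp add: E_dom_def p_def)
    show "- frob (D_X F (H x, p, u (x, t), x, t)) (H x ** H x)
        + (norm p)\<^sup>2 * D_u ul uu F (H x, p, u (x, t), x, t) + D_x F (H x, p, u (x, t), x, t) \<bullet> p \<le> 0"
      by (rule F_structure[OF E[of x, folded p_def] Hp])
  qed (rule Y(3), rule test(2))
  ultimately have le: "2 * (K (0, 1) \<bullet> p) \<le> 0" by simp
  have "((\<lambda>s. (norm (g s x))\<^sup>2) has_real_derivative 2 * (K (0, 1) \<bullet> p)) (at t)"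
    unfolding power2_norm_eq_inner has_real_derivative_iff_has_vector_derivative
    by (rule has_vector_derivative_eq_rhs[OF bounded_bilinear.has_vector_derivative[OF bounded_bilinear_inner gt gt]])
       (simp add: inner_commute p_def)
  then show ?thesis using le by blast
qed

text \<open>The factor \<open>\<sigma>\<close> treats maxima and minima together, a negative
  \<open>\<sigma>\<close> turning a minimum of \<open>u\<close> into a maximum. The second
  derivative test is applied on lines through \<open>x\<close>.\<close>

lemma hess_at_spatial_max:
  fixes u :: "(real ^ 'n::finite) \<times> real \<Rightarrow> real"
  assumes C3: "Ck_on 3 (UNIV \<times> {0..}) u" and t: "0 < t"
    and \<sigma>: "\<And>y. \<sigma> * u (y, t) \<le> \<sigma> * u (x, t)" "\<sigma> \<noteq> 0"
  shows "grad (\<lambda>y. u (y, t)) x = 0" "\<sigma> * (\<xi> \<bullet> (hess (\<lambda>y. u (y, t)) x *v \<xi>)) \<le> 0"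
proof -
  define S where "S = (UNIV :: (real ^ 'n) set) \<times> {0::real<..}"
  define g where "g y = grad (\<lambda>y. u (y, t)) y" for y
  have line: "((\<lambda>s. x + s *\<^sub>R \<xi>) has_derivative (\<lambda>r. r *\<^sub>R \<xi>)) (at s)" for s \<xi>
    by (auto intro!: derivative_eq_intros)
  have ud: "((\<lambda>y. u (y, t)) has_derivative (\<lambda>h. g y \<bullet> h)) (at y)" for y
    using spatial_grad_has_derivative[of 2 u t y] C3 t by (simp add: eval_nat_numeral g_def del: Ck_on.simps)
  have gd: "(g has_derivative (\<lambda>h. hess (\<lambda>y. u (y, t)) x *v h)) (at x)"
    using grad_slice[OF C3 S_def t] by (simp add: g_def[abs_def])
  have d: "((\<lambda>s. \<sigma> * u (x + s *\<^sub>R \<xi>, t)) has_real_derivative \<sigma> * (g (x + s *\<^sub>R \<xi>) \<bullet> \<xi>)) (at s)" for s \<xi>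
    by (rule DERIV_cmult) (use has_derivative_compose[OF line ud] in \<open>simp add: has_field_derivative_def mult_commute_abs\<close>)
  have "((\<lambda>s. g (x + s *\<^sub>R \<xi>) \<bullet> \<xi>) has_derivative (\<lambda>r. (hess (\<lambda>y. u (y, t)) x *v (r *\<^sub>R \<xi>)) \<bullet> \<xi>)) (at 0)" for \<xi>
    by (rule has_derivative_inner_left) (use has_derivative_compose[OF line[of \<xi> 0], of g] gd in simp)
  then have dd: "((\<lambda>s. \<sigma> * (g (x + s *\<^sub>R \<xi>) \<bullet> \<xi>)) has_real_derivative \<sigma> * (\<xi> \<bullet> (hess (\<lambda>y. u (y, t)) x *v \<xi>))) (at 0)" for \<xi>
    by (intro DERIV_cmult) (simp add: has_field_derivative_def mult_commute_abs matrix_vector_mult_scaleR inner_commute)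
  have m: "\<sigma> * u (x + s *\<^sub>R \<xi>, t) \<le> \<sigma> * u (x + 0 *\<^sub>R \<xi>, t)" for s \<xi> using \<sigma>(1) by simp
  show "\<sigma> * (\<xi> \<bullet> (hess (\<lambda>y. u (y, t)) x *v \<xi>)) \<le> 0"
    by (rule second_derivative_test_max(2)[OF m d dd])
  \<comment> \<open>The first-order condition is tested in the direction of the gradient
    itself.\<close>
  have "g x \<bullet> g x = 0"
    using second_derivative_test_max(1)[OF m d dd, of "g x"] \<sigma>(2) by simp
  then show "grad (\<lambda>y. u (y, t)) x = 0" by (simp add: g_def)
qed

section \<open>Suprema of periodic functions and the final estimates\<close>

lemma Linf_norm_upper:
  assumes "bdd_above (range (\<lambda>x. norm (g x)))"
  shows "norm (g x) \<le> Linf_norm g"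
  unfolding Linf_norm_def using assms by (rule cSUP_upper[rotated]) simp

lemma periodic_attains_max:
  fixes f :: "real ^ 'n \<Rightarrow> real"
  assumes "continuous_on UNIV f" "\<And>x k. k \<in> int_lattice \<Longrightarrow> f (x + k) = f x"
  obtains a where "\<And>x. f x \<le> f a"
proof -
  \<comment> \<open>The translate of 0 into the unit cell witnesses that the cell is
    nonempty.\<close>
  obtain a where a: "\<And>y. y \<in> cbox 0 1 \<Longrightarrow> f y \<le> f a"
    using continuous_attains_sup[OF compact_cbox, of 0 1 f] continuous_on_subset[OF assms(1)]
      int_lattice_translate_unit_cell[of 0] by (metis empty_iff top_greatest)
  have "f x \<le> f a" for x
    by (rule int_lattice_translate_unit_cell[of x]) (metis a assms(2))
  then show ?thesis by (rule that)
qed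

lemma grad_translate:
  assumes "\<And>y. f (y + k) = f y" and "(f has_derivative (\<lambda>h. grad f (x + k) \<bullet> h)) (at (x + k))"
  shows "grad f (x + k) = grad f x"
proof -
  have "((\<lambda>y. f (y + k)) has_derivative (\<lambda>h. grad f (x + k) \<bullet> h)) (at x)"
    by (rule has_derivative_compose[where f = "\<lambda>y. y + k" and f' = "\<lambda>h. h" and g = f])
       (auto intro!: derivative_eq_intros assms(2))
  then have "GDERIV f x :> grad f (x + k)"
    using assms(1) by (simp add: gderiv_def inner_commute)
  then show ?thesis by (rule grad_eq[symmetric])
qed

theorem theorem1p2:
  fixes ul uu M :: real
    and F :: "('n::finite) point \<Rightarrow> real"
    and u :: "(real ^ 'n) \<times> real \<Rightarrow> real"
    and u0 :: "real ^ 'n \<Rightarrow> real"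
  assumes ul_uu: "ul < uu"
    and M_pos: "0 < M"
    and F_periodic: "\<And>X p v x t k. (X, p, v, x, t) \<in> E_dom ul uu M \<Longrightarrow> k \<in> int_lattice \<Longrightarrow>
          F (X, p, v, x + k, t) = F (X, p, v, x, t)"
    and F_C1: "Ck_on 1 (E_dom ul uu M) F"
    and F_elliptic: "\<And>X Y p v x t. X \<in> sym_mats \<Longrightarrow> Y \<in> sym_mats \<Longrightarrow> p \<in> cball 0 M \<Longrightarrow>
          v \<in> {ul..uu} \<Longrightarrow> 0 < t \<Longrightarrow> mat_le X Y \<Longrightarrow> F (X, p, v, x, t) \<le> F (Y, p, v, x, t)"
    and F_structure: "\<And>X p v x t. (X, p, v, x, t) \<in> E_dom ul uu M \<Longrightarrow> X *v p = 0 \<Longrightarrow>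
          - frob (D_X F (X, p, v, x, t)) (X ** X) + (norm p)\<^sup>2 * D_u ul uu F (X, p, v, x, t)
            + D_x F (X, p, v, x, t) \<bullet> p \<le> 0"
    and u_periodic: "\<And>x t k. 0 \<le> t \<Longrightarrow> k \<in> int_lattice \<Longrightarrow> u (x + k, t) = u (x, t)"
    and u_C3: "Ck_on 3 (UNIV \<times> {0..}) u"
    and u_eq: "\<And>x t. 0 < t \<Longrightarrow> ((\<lambda>s. u (x, s)) has_real_derivative
          F (hess (\<lambda>y. u (y, t)) x, grad (\<lambda>y. u (y, t)) x, u (x, t), x, t)) (at t)"
    and u_init: "\<And>x. u (x, 0) = u0 x"
    and u_range: "\<And>x t. 0 \<le> t \<Longrightarrow> ul \<le> u (x, t) \<and> u (x, t) \<le> uu"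
    and Du_bound: "\<And>t. 0 \<le> t \<Longrightarrow> Linf_norm (grad (\<lambda>y. u (y, t))) \<le> M"
  shows "(\<forall>t\<ge>0. Linf_norm (grad (\<lambda>y. u (y, t))) \<le> Linf_norm (grad u0)) \<and>
         ((\<forall>C\<in>{ul..uu}. \<forall>x. \<forall>t>0. F (0, 0, C, x, t) = 0) \<longrightarrow>
          (\<forall>t\<ge>0. \<forall>x. (LEAST m. m \<in> range u0) \<le> u (x, t) \<and>
                      u (x, t) \<le> (GREATEST m. m \<in> range u0)))"
proof -
  define g where "g = (\<lambda>t y. grad (\<lambda>y. u (y, t)) y)"
  have u_C3': "Ck_on (Suc 2) (UNIV \<times> {0..}) u"
    using u_C3 by (simp add: eval_nat_numeral del: Ck_on.simps)
  have ud: "((\<lambda>y. u (y, t)) has_derivative (\<lambda>h. g t x \<bullet> h)) (at x)" if "0 \<le> t" for x t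
    using spatial_grad_has_derivative[OF u_C3' that] by (simp add: g_def)
  have gc: "continuous_on (UNIV \<times> {0..}) (\<lambda>z. g (snd z) (fst z))"
    using spatial_grad_continuous[OF u_C3'] by (simp add: g_def)
  have uc: "continuous_on (UNIV \<times> {0..}) u"
    using Ck_on_mono[OF u_C3, of 0] by simp
  have gper: "g t (x + k) = g t x" if "0 \<le> t" "k \<in> int_lattice" for t x k
    unfolding g_def
    by (rule grad_translate) (use u_periodic ud[OF that(1)] that in \<open>auto simp: g_def\<close>)
  have slice: "continuous_on UNIV (\<lambda>y. f (y, t))" if "continuous_on (UNIV \<times> {0..}) f" "0 \<le> t"
    for f :: "(real ^ 'n) \<times> real \<Rightarrow> real" and t
    by (rule continuous_on_compose2[OF that(1)]) (use that(2) in \<open>auto intro!: continuous_intros\<close>)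
  have ngc: "continuous_on (UNIV \<times> {0..}) (\<lambda>z. norm (g (snd z) (fst z)))"
    by (intro continuous_on_norm gc)
  \<comment> \<open>The supremum in \<open>Linf_norm\<close> bounds the values only if they are
    bounded above, which continuity and periodicity ensure.\<close>
  have bdd: "bdd_above (range (\<lambda>x. norm (g t x)))" if t: "0 \<le> t" for t
  proof -
    obtain a where "\<And>x. norm (g t x) \<le> norm (g t a)"
      using periodic_attains_max[of "\<lambda>x. norm (g t x)"] slice[OF ngc t] gper[OF t] by auto
    then show ?thesis by (auto intro!: bdd_aboveI)
  qed
  have gM: "norm (g t x) \<le> M" if "0 \<le> t" for t x
    using Linf_norm_upper[OF bdd[OF that], of x] Du_bound[OF that] by (simp add: g_def)
  have u0: "u0 = (\<lambda>y. u (y, 0))" using u_init by auto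
  have "Linf_norm (g t) \<le> Linf_norm (g 0)" if t: "0 \<le> t" for t
  proof -
    \<comment> \<open>The maximum principle is applied to the square, which stays differentiable
      where the gradient vanishes.\<close>
    have "(norm (g t x))\<^sup>2 \<le> (Linf_norm (g 0))\<^sup>2" for x
    proof (rule periodic_maximum_principle[of "\<lambda>z. (norm (g (snd z) (fst z)))\<^sup>2", unfolded fst_conv snd_conv])
      fix x t assume t: "0 < t" and max: "\<And>y. (norm (g t y))\<^sup>2 \<le> (norm (g t x))\<^sup>2"
      show "\<exists>D\<le>0. ((\<lambda>s. (norm (g s x))\<^sup>2) has_real_derivative D) (at t)"
        unfolding g_def
        by (rule grad_norm_critical[OF u_C3 F_C1 ul_uu F_elliptic F_structure u_eq u_range _ t])
           (use gM max in \<open>auto simp: g_def\<close>)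
    next
      fix x show "(norm (g 0 x))\<^sup>2 \<le> (Linf_norm (g 0))\<^sup>2"
        by (intro power_mono Linf_norm_upper bdd) auto
    qed (use t gper in \<open>auto intro!: continuous_on_power ngc\<close>)
    moreover have "0 \<le> Linf_norm (g 0)"
      using Linf_norm_upper[OF bdd[of 0], of 0] norm_ge_zero order_trans by blast
    ultimately have "norm (g t x) \<le> Linf_norm (g 0)" for x
      using power2_le_imp_le by blast
    then show ?thesis
      unfolding Linf_norm_def[of "g t"] by (intro cSUP_least) auto
  qed
  then have part1: "\<forall>t\<ge>0. Linf_norm (grad (\<lambda>y. u (y, t))) \<le> Linf_norm (grad u0)"
    by (simp add: g_def u0)
  \<comment> \<open>The upper bound is the case \<open>\<sigma> = 1\<close>; the lower bound is the
    case \<open>\<sigma> = -1\<close>, with \<open>B\<close> the negative of the minimum.\<close>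
  have part2: "\<sigma> * u (x, t) \<le> B"
    if F0: "\<forall>C\<in>{ul..uu}. \<forall>x. \<forall>t>0. F (0, 0, C, x, t) = 0" and t: "0 \<le> t"
      and \<sigma>: "\<sigma> = 1 \<or> \<sigma> = -1" and B: "\<And>x. \<sigma> * u (x, 0) \<le> B" for \<sigma> B x t
  proof (rule periodic_maximum_principle[of "\<lambda>z. \<sigma> * u z"])
    fix x t assume t: "0 < t" and max: "\<And>y. \<sigma> * u (y, t) \<le> \<sigma> * u (x, t)"
    let ?X = "hess (\<lambda>y. u (y, t)) x"
    have X: "?X \<in> sym_mats" by (rule hess_sym[OF u_C3 refl t])
    have 0: "0 \<in> sym_mats" by (rule subspace_0[OF sym_mats_subspace])
    have h: "grad (\<lambda>y. u (y, t)) x = 0" "\<sigma> * (\<xi> \<bullet> (?X *v \<xi>)) \<le> 0" for \<xi>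
      using hess_at_spatial_max[OF u_C3 t max] \<sigma> by auto
    have v: "u (x, t) \<in> {ul..uu}" using u_range[of t x] t by simp
    have F00: "F (0, 0, u (x, t), x, t) = 0" using F0 v t by blast
    \<comment> \<open>Ellipticity compares \<open>?X\<close> with the zero matrix, where
      \<open>F\<close> vanishes; the sign of \<open>\<sigma>\<close> decides which of the two is
      larger.\<close>
    have "\<sigma> * F (?X, 0, u (x, t), x, t) \<le> 0"
    proof (cases "\<sigma> = 1")
      case True
      then have "mat_le ?X 0"
        using h(2) matrix_vector_mult_diff_rdistrib[of 0 ?X] by (simp add: mat_le_def)
      then show ?thesis
        using F_elliptic[where p = 0 and x = x, OF X 0 _ v t] F00 M_pos True by simp
    next
      case False
      then have \<sigma>: "\<sigma> = -1" using \<sigma> by simp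
      then have "mat_le 0 ?X"
        using h(2) by (simp add: mat_le_def)
      then show ?thesis
        using F_elliptic[where p = 0 and x = x, OF 0 X _ v t] F00 M_pos \<sigma> by simp
    qed
    moreover have "((\<lambda>s. \<sigma> * u (x, s)) has_real_derivative \<sigma> * F (?X, 0, u (x, t), x, t)) (at t)"
      using DERIV_cmult[OF u_eq[OF t, of x]] by (simp add: h(1))
    ultimately show "\<exists>D\<le>0. ((\<lambda>s. \<sigma> * u (x, s)) has_real_derivative D) (at t)" by blast
  qed (use t B u_periodic uc in \<open>auto intro: continuous_on_mult_left\<close>)
  have "(LEAST m. m \<in> range u0) \<le> u (x, t) \<and> u (x, t) \<le> (GREATEST m. m \<in> range u0)"
    if F0: "\<forall>C\<in>{ul..uu}. \<forall>x. \<forall>t>0. F (0, 0, C, x, t) = 0" and t: "0 \<le> t" for x t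
  proof
    have c0: "continuous_on UNIV u0" using slice[OF uc, of 0] by (simp add: u0)
    have per0: "u0 (x + k) = u0 x" if "k \<in> int_lattice" for x k
      using u_periodic[OF _ that, of 0] by (simp add: u0)
    obtain a where a: "\<And>x. u0 x \<le> u0 a"
      using periodic_attains_max[OF c0 per0] by blast
    obtain b where b: "\<And>x. u0 b \<le> u0 x"
      using periodic_attains_max[OF continuous_on_minus[OF c0]] per0 by auto
    \<comment> \<open>\<open>LEAST\<close> on the reals denotes the minimum here because it is
      attained, at \<open>b\<close>.\<close>
    have "(LEAST m. m \<in> range u0) = u0 b"
      by (rule Least_equality) (use b in auto)
    then show "(LEAST m. m \<in> range u0) \<le> u (x, t)"
      using part2[OF F0 t, of "-1" "- u0 b" x] b by (simp add: u_init)
    have "(GREATEST m. m \<in> range u0) = u0 a"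
      by (rule Greatest_equality) (use a in auto)
    then show "u (x, t) \<le> (GREATEST m. m \<in> range u0)"
      using part2[OF F0 t, of 1 "u0 a" x] a by (simp add: u_init)
  qed
  with part1 show ?thesis by blast
qed

end
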